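(* Let $w$ be a Baxter permutation of length $n$ that is fixed under $90^{\circ}$ rotation, and let $p$ be a position such that inserting a new largest entry $n+1$ into $w$ at position $p$ (i.e. between the same consecutive entries of $w$, or at an end) yields a Baxter permutation. Then it is possible to additionally insert a new smallest entry, a new first entry and a new last entry so that the result is a Baxter permutation $w'$ of length $n+4$ that is fixed under $90^{\circ}$ rotation; that is, there is a Baxter permutation $w'$ of length $n+4$ fixed under $90^{\circ}$ rotation such that deleting from $w'$ its largest entry, its smallest entry, its first entry and its last entry (and standardizing the remaining entries to $[n]$) gives $w$, and in which the largest entry $n+4$ lies in the same gap between entries originating from $w$ as the inserted $n+1$ occupies at position $p$.
   Context: A permutation $w=w_1\ldots w_n$ is a Baxter permutation if there are no indices $i<j<j+1<k$ with $w_j<w_k<w_i<w_{j+1}$ (pattern 3-14-2) and no indices $i<j<j+1<k$ with $w_{j+1}<w_i<w_k<w_j$ (pattern 2-41-3). A permutation $w$ of length $n$ is fixed under $90^{\circ}$ rotation (of its permutation matrix) if for all $i$, $w_i=j$ implies $w_j=n+1-i$ (equivalently $w_{w_i}=n+1-i$ for all $i$). Inserting a new smallest entry means increasing all entries by $1$ and inserting $1$ somewhere; inserting a new first (resp. last) entry $j$ means increasing all entries $\ge j$ by $1$ and prepending (resp. appending) $j$.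
   Formalization: The length n is assumed to be at least 1; for the empty permutation the claim fails, since the only permutations of length 4 fixed under 90° rotation are 2413 and 3142, and neither is Baxter. *)

theory Defs
  imports "HOL-Combinatorics.Multiset_Permutations"
begin

text \<open>
  A permutation \<open>w\<^sub>1 \<dots> w\<^sub>n\<close> in one-line notation is a list \<open>w \<in> permutations_of_set {1..n}\<close>;
  the entry \<open>w\<^sub>i\<close> is \<open>w ! (i - 1)\<close>.
\<close>

text \<open>The patterns 3-14-2 and 2-41-3; they only involve the relative order of the
  positions, so the list indices are used directly.\<close>

definition baxter :: "nat list \<Rightarrow> bool" where
  "baxter w \<longleftrightarrow>
     (\<nexists>i j k. i < j \<and> j + 1 < k \<and> k < length w \<and>
        w ! j < w ! k \<and> w ! k < w ! i \<and> w ! i < w ! (j + 1)) \<and>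
     (\<nexists>i j k. i < j \<and> j + 1 < k \<and> k < length w \<and>
        w ! (j + 1) < w ! i \<and> w ! i < w ! k \<and> w ! k < w ! j)"

definition baxter_perm :: "nat \<Rightarrow> nat list \<Rightarrow> bool" where
  "baxter_perm n w \<longleftrightarrow> w \<in> permutations_of_set {1..n} \<and> baxter w"

definition rotation_fixed :: "nat list \<Rightarrow> bool" where
  "rotation_fixed w \<longleftrightarrow>
     (\<forall>i \<in> {1..length w}. \<forall>j \<in> {1..length w}.
        w ! (i - 1) = j \<longrightarrow> w ! (j - 1) = length w + 1 - i)"

text \<open>The gap \<open>p\<close> is the one preceded by exactly \<open>p\<close> entries of \<open>w\<close>.\<close>

definition insert_largest :: "nat \<Rightarrow> nat list \<Rightarrow> nat list" where
  "insert_largest p w = take p w @ [length w + 1] @ drop p w"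

definition standardize :: "nat list \<Rightarrow> nat list" where
  "standardize xs = map (\<lambda>x. card {y \<in> set xs. y \<le> x}) xs"

definition inner_entry :: "nat list \<Rightarrow> nat \<Rightarrow> bool" where
  "inner_entry w x \<longleftrightarrow> x \<notin> {Max (set w), Min (set w), hd w, last w}"

definition delete_outer :: "nat list \<Rightarrow> nat list" where
  "delete_outer w = filter (inner_entry w) w"

definition largest_gap :: "nat list \<Rightarrow> nat" where
  "largest_gap w = length (filter (inner_entry w) (takeWhile (\<lambda>x. x \<noteq> Max (set w)) w))"

end

theory Submission
  imports Defs
begin

text \<open>
  Draw \<open>w\<close> as the points \<open>(2i - n - 1, 2w\<^sub>i - n - 1)\<close>, so that the rotation becomes
  \<open>(x, y) \<mapsto> (y, - x)\<close>. The new largest entry is the point \<open>T = (t, m)\<close> with \<open>t = 2p - n\<close>,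
  \<open>m = n + 1\<close>, and rotation invariance forces the other three new points to be its rotations
  \<open>R = (m, - t)\<close>, \<open>B = (- t, - m)\<close>, \<open>L = (- m, t)\<close>.

  An occurrence of 3-14-2 can be shrunk until its entries 3 and 2 are consecutive in value as well;
  such tight occurrences are permuted by the rotation, and the reflection \<open>(x, y) \<mapsto> (x, - y)\<close>
  exchanges the two forbidden patterns, so only 3-14-2 has to be treated.
  The new points \<open>L, B, T, R\<close> can only play the parts 3, 1, 4, 2 respectively. A rotation-fixed
  Baxter permutation has odd length (otherwise its four central points form a forbidden pattern),
  so the origin is a point and separates \<open>L\<close> from \<open>R\<close> and \<open>B\<close> from \<open>T\<close>: opposite new points are
  never in the same tight occurrence. If \<open>T\<close> is in one but \<open>R\<close> is not, then the part 3 is \<open>L\<close>,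
  because \<open>w\<close> with \<open>T\<close> is Baxter; and then every old point left of \<open>T\<close> lies below \<open>L\<close>. There are
  as many old points left of \<open>T\<close> as below \<open>L\<close>, so the two sets coincide, although the part 2
  belongs only to the second. Hence \<open>T\<close> always comes with \<open>R\<close>; rotating, \<open>L\<close> comes with \<open>T\<close>,
  hence with \<open>R\<close>, which is impossible.
\<close>

section \<open>Tight occurrences of 3-14-2 in planar point sets, and the quarter turn\<close>

definition rot :: "int \<times> int \<Rightarrow> int \<times> int" where
  "rot s = (snd s, - fst s)"

definition vflip :: "int \<times> int \<Rightarrow> int \<times> int" where
  "vflip s = (fst s, - snd s)"

text \<open>The points \<open>a\<close>, \<open>b\<close>, \<open>c\<close>, \<open>d\<close> play
  the parts 3, 1, 4, 2. Adjacency is expressed by an empty vertical strip, so points can be inserted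
  without renumbering columns.\<close>

definition occ_3142 :: "(int \<times> int) set \<Rightarrow> int \<times> int \<Rightarrow> int \<times> int \<Rightarrow> int \<times> int \<Rightarrow> int \<times> int \<Rightarrow> bool" where
  "occ_3142 S a b c d \<longleftrightarrow> a \<in> S \<and> b \<in> S \<and> c \<in> S \<and> d \<in> S \<and>
     fst a < fst b \<and> fst b < fst c \<and> fst c < fst d \<and>
     snd b < snd d \<and> snd d < snd a \<and> snd a < snd c \<and>
     (\<forall>e\<in>S. \<not> (fst b < fst e \<and> fst e < fst c))"

definition tight_3142 :: "(int \<times> int) set \<Rightarrow> int \<times> int \<Rightarrow> int \<times> int \<Rightarrow> int \<times> int \<Rightarrow> int \<times> int \<Rightarrow> bool" where
  "tight_3142 S a b c d \<longleftrightarrow> occ_3142 S a b c d \<and> (\<forall>e\<in>S. \<not> (snd d < snd e \<and> snd e < snd a))"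

definition avoids_3142 :: "(int \<times> int) set \<Rightarrow> bool" where
  "avoids_3142 S \<longleftrightarrow> (\<nexists>a b c d. occ_3142 S a b c d)"

lemma occ_3142D:
  assumes "occ_3142 S a b c d"
  shows "a \<in> S" "b \<in> S" "c \<in> S" "d \<in> S"
    and "fst a < fst b" "fst b < fst c" "fst c < fst d"
    and "snd b < snd d" "snd d < snd a" "snd a < snd c"
    and "e \<in> S \<Longrightarrow> \<not> (fst b < fst e \<and> fst e < fst c)"
  using assms unfolding occ_3142_def by blast+

lemma tight_3142D:
  assumes "tight_3142 S a b c d"
  shows "occ_3142 S a b c d" "e \<in> S \<Longrightarrow> \<not> (snd d < snd e \<and> snd e < snd a)"
  using assms unfolding tight_3142_def by blast+

text \<open>The strip between \<open>b\<close> and \<open>c\<close> is empty, so a point at a height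
  between \<open>d\<close> and \<open>a\<close> lies left of \<open>b\<close> or right of
  \<open>c\<close>. It can replace \<open>a\<close> or \<open>d\<close> respectively, which shrinks
  the height gap.\<close>

lemma tight_3142_exists:
  assumes "inj_on fst S" "occ_3142 S a b c d"
  shows "\<exists>a d. tight_3142 S a b c d"
  using assms(2)
proof (induction "nat (snd a - snd d)" arbitrary: a d rule: less_induct)
  case less
  show ?case
  proof (cases "tight_3142 S a b c d")
    case False
    then obtain e where e: "e \<in> S" "snd d < snd e" "snd e < snd a"
      using less.prems by (auto simp: tight_3142_def)
    note o = less.prems[unfolded occ_3142_def]
    have "e \<noteq> b" "e \<noteq> c" using e o by auto
    then have "fst e \<noteq> fst b" "fst e \<noteq> fst c"
      using assms(1) e(1) o by (auto dest: inj_onD)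
    then consider "fst e < fst b" | "fst c < fst e"
      using o e(1) by (meson linorder_neqE)
    then show ?thesis
    proof cases
      case 1
      then have "occ_3142 S e b c d" using o e by (auto simp: occ_3142_def)
      then show ?thesis using less.hyps[of e d] e by simp
    next
      case 2
      then have "occ_3142 S a b c e" using o e by (auto simp: occ_3142_def)
      then show ?thesis using less.hyps[of a e] e by simp
    qed
  qed blast
qed

text \<open>The turn exchanges the two empty strips and sends the parts 1, 2, 3, 4 to the parts 3,
  1, 4, 2.\<close>

lemma tight_3142_rot:
  "tight_3142 S a b c d \<Longrightarrow> tight_3142 (rot ` S) (rot b) (rot d) (rot a) (rot c)"
  by (auto simp: tight_3142_def occ_3142_def rot_def)

text \<open>An occurrence in the image is first tightened; three more turns then bring it back to
  \<open>S\<close>.\<close>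

lemma avoids_3142_rot:
  assumes "inj_on snd S" "avoids_3142 S"
  shows "avoids_3142 (rot ` S)"
proof (rule ccontr)
  assume "\<not> avoids_3142 (rot ` S)"
  moreover have inj: "inj_on fst (rot ` S)"
    using assms(1) by (auto simp: inj_on_def rot_def)
  ultimately obtain a b c d where "tight_3142 (rot ` S) a b c d"
    unfolding avoids_3142_def by (meson tight_3142_exists)
  then have "\<exists>a b c d. tight_3142 (rot ` rot ` rot ` rot ` S) a b c d"
    by (meson tight_3142_rot)
  moreover have "rot ` rot ` rot ` rot ` S = S"
    by (simp add: image_image rot_def)
  ultimately show False
    using assms(2) unfolding avoids_3142_def tight_3142_def by metis
qed

lemma inj_on_snd_rot: "inj_on fst S \<Longrightarrow> inj_on snd (rot ` S)"
  by (auto simp: inj_on_def rot_def)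

subsection \<open>Adding the four new points\<close>

locale frame =
  fixes S :: "(int \<times> int) set" and m t :: int
  assumes finite_S: "finite S"
    and rot_S: "rot ` S = S"
    and inj_fst: "inj_on fst S"
    and bounded: "s \<in> S \<Longrightarrow> \<bar>fst s\<bar> < m"
    and origin: "(0, 0) \<in> S"
    and t_bound: "\<bar>t\<bar> < m"
    and t_new: "t \<notin> fst ` S"
    and avoids_S: "avoids_3142 S"
    and avoids_top: "avoids_3142 (insert (t, m) S)"
begin

abbreviation "outer \<equiv> {(t, m), (- m, t), (m, - t), (- t, - m)}"

lemma rot_in: "s \<in> S \<Longrightarrow> (snd s, - fst s) \<in> S"
  using rot_S by (auto simp: rot_def)

lemma rot_in': "s \<in> S \<Longrightarrow> (- snd s, fst s) \<in> S"
  using rot_in[OF rot_in[OF rot_in]] by simp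

lemma bounded': "s \<in> S \<Longrightarrow> \<bar>snd s\<bar> < m"
  using bounded rot_in by fastforce

lemma coord_new:
  assumes "s \<in> S"
  shows "fst s \<noteq> t" "fst s \<noteq> - t" "snd s \<noteq> t" "snd s \<noteq> - t" 
  using t_new rot_in[OF assms] rot_in'[OF assms] rot_in[OF rot_in[OF assms]] assms
  by (force simp: image_iff)+

lemma t_nonzero: "t \<noteq> 0"
  using coord_new(1)[OF origin] by simp

lemma rot_all: "rot ` (S \<union> outer) = S \<union> outer"
  using rot_S by (auto simp: image_Un rot_def)

lemma inj_all: "inj_on fst (S \<union> outer)"
  using inj_fst t_bound t_nonzero coord_new(1,2) bounded
  by (simp add: inj_on_Un) (force simp: image_iff)

lemma card_all: "card (S \<union> outer) = card S + 4"
proof -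
  have "S \<inter> outer = {}" using bounded bounded' by fastforce
  then have "card (S \<union> outer) = card S + card outer"
    by (intro card_Un_disjoint finite_S) simp_all
  also have "card outer = 4" using t_bound t_nonzero by auto
  finally show ?thesis .
qed

text \<open>The counterclockwise quarter turn makes abscissas into ordinates.\<close>

lemma card_halfplanes: "card {s \<in> S. fst s < t} = card {s \<in> S. snd s < t}"
proof -
  have "bij_betw (\<lambda>s. (- snd s, fst s)) {s \<in> S. fst s < t} {s \<in> S. snd s < t}"
    by (rule bij_betwI[where g = rot]) (auto simp: rot_def intro: rot_in[of "(_, _)", simplified] rot_in'[of "(_, _)", simplified])
  then show ?thesis by (rule bij_betw_same_card)
qed

text \<open>Each part of 3-14-2 is extreme in one direction only (3 left, 1 down, 4 up, 2 right),
  and so is each new point among all points. The last two claims hold since the origin would lie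
  inside an empty strip.\<close>

lemma roles:
  assumes "tight_3142 (S \<union> outer) a b c d"
  shows "a \<in> insert (- m, t) S" "b \<in> insert (- t, - m) S" "c \<in> insert (t, m) S" "d \<in> insert (m, - t) S"
    "\<not> (a = (- m, t) \<and> d = (m, - t))" "\<not> (b = (- t, - m) \<and> c = (t, m))"
proof -
  note occ = tight_3142D(1)[OF assms]
  note mem = occ_3142D(1-4)[OF occ] and ord = occ_3142D(5-10)[OF occ]
  have adj: "\<not> (fst b < 0 \<and> 0 < fst c)" "\<not> (snd d < 0 \<and> 0 < snd a)"
    using occ_3142D(11)[OF occ, of "(0, 0)"] tight_3142D(2)[OF assms, of "(0, 0)"] origin by auto
  have bd: "- m \<le> fst s" "fst s \<le> m" "- m \<le> snd s" "snd s \<le> m" if "s \<in> S \<union> outer" for s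
    using that bounded[of s] bounded'[of s] t_bound by auto
  have "a \<notin> {(t, m), (m, - t), (- t, - m)}"
    using ord bd[OF mem(2)] bd[OF mem(3)] by auto
  then show "a \<in> insert (- m, t) S" using mem(1) by blast
  have "b \<notin> {(t, m), (- m, t), (m, - t)}"
    using ord bd[OF mem(1)] bd[OF mem(3)] by auto
  then show "b \<in> insert (- t, - m) S" using mem(2) by blast
  have "c \<notin> {(- m, t), (m, - t), (- t, - m)}"
    using ord bd[OF mem(2)] bd[OF mem(4)] by auto
  then show "c \<in> insert (t, m) S" using mem(3) by blast
  have "d \<notin> {(t, m), (- m, t), (- t, - m)}"
    using ord bd[OF mem(2)] bd[OF mem(3)] by auto
  then show "d \<in> insert (m, - t) S" using mem(4) by blast
  show "\<not> (a = (- m, t) \<and> d = (m, - t))" "\<not> (b = (- t, - m) \<and> c = (t, m))"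
    using ord adj by auto
qed

lemma tight_top:
  assumes tight: "tight_3142 (S \<union> outer) a b (t, m) d"
  shows "d = (m, - t)"
proof (rule ccontr)
  assume "d \<noteq> (m, - t)"
  then have d: "d \<in> S" and b: "b \<in> S" using roles[OF tight] by auto
  note occ = tight_3142D(1)[OF tight]
  note o = occ_3142D(5-10)[OF occ]
  have adj: "fst s \<le> fst b \<or> t \<le> fst s" if "s \<in> S" for s
    using occ_3142D(11)[OF occ, of s] that by auto
  \<comment> \<open>An old point left of \<open>b\<close> and above \<open>d\<close> could play the
    part 3 with \<open>b\<close>, \<open>(t, m)\<close>, \<open>d\<close>, contradicting
    \<open>avoids_top\<close>.\<close>
  have no: "snd s < snd d" if "s \<in> S" "fst s < fst b" for s
  proof (rule ccontr)
    assume "\<not> snd s < snd d"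
    moreover have "snd s \<noteq> snd d"
    proof
      assume "snd s = snd d"
      \<comment> \<open>Equal ordinates become equal abscissas after a turn, where
        \<open>inj_fst\<close> applies.\<close>
      then have "s = d" using that(1) d inj_fst rot_in
        by (metis inj_onD fst_conv neg_equal_iff_equal prod.collapse snd_conv)
      then show False using that o by simp
    qed
    ultimately have "occ_3142 (insert (t, m) S) s b (t, m) d"
      using o that b d bounded'[OF that(1)] adj by (force simp: occ_3142_def)
    then show False using avoids_top unfolding avoids_3142_def by blast
  qed
  have "a \<notin> S" using no[of a] o by auto
  then have a: "a = (- m, t)" using roles(1)[OF tight] by auto
  have "snd s < t" if s: "s \<in> S" "fst s < t" for s
  proof -
    have "fst s \<le> fst b" using adj[OF s(1)] s(2) by linarith
    then have "s = b \<or> fst s < fst b" using inj_fst s b by (metis inj_onD order_le_less)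
    then show ?thesis using no[OF s(1)] o a by auto
  qed
  then have "{s \<in> S. fst s < t} \<subseteq> {s \<in> S. snd s < t}" by auto
  then have "{s \<in> S. fst s < t} = {s \<in> S. snd s < t}"
    using card_halfplanes finite_S by (intro card_subset_eq) auto
  \<comment> \<open>\<open>d\<close> is below height \<open>t\<close> but right of abscissa
    \<open>t\<close>, so it lies in only one of the two equal sets.\<close>
  moreover have "snd d < t" "t < fst d" using o a by auto
  ultimately show False using d by force
qed

lemma tight_rotate:
  "tight_3142 (S \<union> outer) a b c d \<Longrightarrow> tight_3142 (S \<union> outer) (rot b) (rot d) (rot a) (rot c)"
  using tight_3142_rot[of "S \<union> outer" a b c d] rot_all by simp

lemma avoids_all: "avoids_3142 (S \<union> outer)"
proof (rule ccontr)
  assume "\<not> avoids_3142 (S \<union> outer)"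
  then obtain a b c d where tight: "tight_3142 (S \<union> outer) a b c d"
    unfolding avoids_3142_def using inj_all by (meson tight_3142_exists)
  have a: "a \<noteq> (- m, t)" if T: "tight_3142 (S \<union> outer) a b c d" for a b c d
  proof
    assume a: "a = (- m, t)"
    \<comment> \<open>The turned occurrence has \<open>(t, m)\<close> as its part 4, so
      \<open>tight_top\<close> determines its part 2, which is \<open>rot c\<close>.\<close>
    have "rot c = (m, - t)"
      using tight_top[of "rot b" "rot d" "rot c"] tight_rotate[OF T] a by (simp add: rot_def)
    then have "c = (t, m)" by (auto simp: rot_def prod_eq_iff)
    then have "d = (m, - t)" using tight_top T by blast
    then show False using roles(5)[OF T] a by simp
  qed
  \<comment> \<open>Each further turn carries the exclusion over to the next new point and its
    part.\<close>
  have b: "b \<noteq> (- t, - m)" if T: "tight_3142 (S \<union> outer) a b c d" for a b c d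
    using a[OF tight_rotate[OF T]] by (auto simp: rot_def)
  have d: "d \<noteq> (m, - t)" if T: "tight_3142 (S \<union> outer) a b c d" for a b c d
    using b[OF tight_rotate[OF T]] by (auto simp: rot_def)
  have c: "c \<noteq> (t, m)" if T: "tight_3142 (S \<union> outer) a b c d" for a b c d
    using d[OF tight_rotate[OF T]] by (auto simp: rot_def)
  have "a \<in> S" "b \<in> S" "c \<in> S" "d \<in> S"
    using roles[OF tight] a[OF tight] b[OF tight] c[OF tight] d[OF tight] by auto
  then have "occ_3142 S a b c d"
    using occ_3142D[OF tight_3142D(1)[OF tight]] by (simp add: occ_3142_def)
  then show False using avoids_S unfolding avoids_3142_def by blast
qed

end

subsection \<open>From lists to points\<close>

text \<open>For increasing \<open>g\<close>, the strip between two columns is empty exactly when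
  their indices are consecutive. The spacing of \<open>g\<close> is free, so unevenly spaced
  diagrams are covered.\<close>

lemma avoids_3142_image:
  fixes g k :: "nat \<Rightarrow> int"
  assumes g: "strict_mono_on {..<N} g"
  shows "avoids_3142 ((\<lambda>i. (g i, k i)) ` {..<N}) \<longleftrightarrow>
    (\<nexists>i j l. i < j \<and> j + 1 < l \<and> l < N \<and> k j < k l \<and> k l < k i \<and> k i < k (j + 1))"
    (is "avoids_3142 ?S \<longleftrightarrow> \<not> ?R")
proof -
  have less: "g i < g j \<longleftrightarrow> i < j" if "i < N" "j < N" for i j
    using strict_mono_on_less[OF g] that by simp
  have 1: "?R" if occ: "occ_3142 ?S a b c d" for a b c d
  proof -
    obtain i j j' l where ix: "i < N" "j < N" "j' < N" "l < N"
      and eq: "a = (g i, k i)" "b = (g j, k j)" "c = (g j', k j')" "d = (g l, k l)"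
      using occ_3142D(1-4)[OF occ] by blast
    have lt: "i < j" "j < j'" "j' < l" and vals: "k j < k l" "k l < k i" "k i < k j'"
      using occ_3142D(5-10)[OF occ] ix by (simp_all add: eq less)
    have "\<not> (g j < g e \<and> g e < g j')" if "e < N" for e
      using occ_3142D(11)[OF occ, of "(g e, k e)"] that by (auto simp: eq)
    from this[of "j + 1"] have "j' = j + 1" using ix lt by (auto simp: less)
    then show ?R using lt vals ix by blast
  qed
  have 2: "\<exists>a b c d. occ_3142 ?S a b c d" if R: ?R
  proof -
    have mem: "(g i, k i) \<in> ?S" if "i < N" for i using that by blast
    obtain i j l where ix: "i < j" "j + 1 < l" "l < N"
      and vals: "k j < k l" "k l < k i" "k i < k (j + 1)"
      using R by blast
    have gap: "\<forall>e\<in>?S. \<not> (g j < fst e \<and> fst e < g (j + 1))"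
      using ix by (auto simp: less)
    have "g i < g j" "g j < g (j + 1)" "g (j + 1) < g l" using ix by (simp_all add: less)
    then have "occ_3142 ?S (g i, k i) (g j, k j) (g (j + 1), k (j + 1)) (g l, k l)"
      unfolding occ_3142_def fst_conv snd_conv using ix vals gap by (intro conjI mem; simp)
    then show ?thesis by (intro exI)
  qed
  have "(\<exists>a b c d. occ_3142 ?S a b c d) \<longleftrightarrow> ?R"
  proof
    assume "\<exists>a b c d. occ_3142 ?S a b c d"
    then show ?R by (elim exE) (rule 1)
  qed (rule 2)
  then show ?thesis unfolding avoids_3142_def by (rule arg_cong)
qed

text \<open>Negating the heights turns 2-41-3 into 3-14-2.\<close>

lemma baxter_iff_avoids_3142:
  fixes g h :: "nat \<Rightarrow> int"
  assumes g: "strict_mono_on {..<length w} g" and h: "strict_mono_on (set w) h"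
  defines "S \<equiv> (\<lambda>i. (g i, h (w ! i))) ` {..<length w}"
  shows "baxter w \<longleftrightarrow> avoids_3142 S \<and> avoids_3142 (vflip ` S)"
proof -
  have less: "h (w ! i) < h (w ! j) \<longleftrightarrow> w ! i < w ! j" if "i < length w" "j < length w" for i j
    using strict_mono_on_less[OF h] that by simp
  have "vflip ` S = (\<lambda>i. (g i, - h (w ! i))) ` {..<length w}"
    by (simp add: S_def image_image vflip_def)
  then have "avoids_3142 (vflip ` S) \<longleftrightarrow>
    (\<nexists>i j k. i < j \<and> j + 1 < k \<and> k < length w \<and>
        - h (w ! j) < - h (w ! k) \<and> - h (w ! k) < - h (w ! i) \<and> - h (w ! i) < - h (w ! (j + 1)))"
    using avoids_3142_image[OF g, of "\<lambda>i. - h (w ! i)"] by simp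
  also have "\<dots> \<longleftrightarrow> (\<nexists>i j k. i < j \<and> j + 1 < k \<and> k < length w \<and>
        w ! (j + 1) < w ! i \<and> w ! i < w ! k \<and> w ! k < w ! j)"
    by (intro arg_cong[where f = Not] ex_cong1) (auto simp: less)
  finally have 2: "avoids_3142 (vflip ` S) \<longleftrightarrow> \<dots>" .
  have "avoids_3142 S \<longleftrightarrow> (\<nexists>i j k. i < j \<and> j + 1 < k \<and> k < length w \<and>
        h (w ! j) < h (w ! k) \<and> h (w ! k) < h (w ! i) \<and> h (w ! i) < h (w ! (j + 1)))"
    using avoids_3142_image[OF g, of "\<lambda>i. h (w ! i)"] by (simp add: S_def)
  also have "\<dots> \<longleftrightarrow> (\<nexists>i j k. i < j \<and> j + 1 < k \<and> k < length w \<and>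
        w ! j < w ! k \<and> w ! k < w ! i \<and> w ! i < w ! (j + 1))"
    by (intro arg_cong[where f = Not] ex_cong1) (auto simp: less)
  finally show ?thesis using 2 unfolding baxter_def by blast
qed

text \<open>Centring turns \<open>n + 1 - v\<close> into a negation; doubling keeps the values
  integral and leaves an integer midway between neighbouring columns for an inserted point.\<close>

definition coord :: "nat \<Rightarrow> nat \<Rightarrow> int" where
  "coord n v = 2 * int v - int n - 1"

definition points :: "nat \<Rightarrow> nat list \<Rightarrow> (int \<times> int) set" where
  "points n w = (\<lambda>i. (coord n (Suc i), coord n (w ! i))) ` {..<n}"

lemma perm_list:
  assumes "w \<in> permutations_of_set {1..n}"
  shows "length w = n" "set w = {1..n}" "distinct w" "i < n \<Longrightarrow> 1 \<le> w ! i \<and> w ! i \<le> n"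
proof -
  show 1: "length w = n" "set w = {1..n}" "distinct w"
    using assms length_finite_permutations_of_set[of w "{1..n}"] by (auto simp: permutations_of_set_def)
  show "1 \<le> w ! i \<and> w ! i \<le> n" if "i < n"
    using 1 nth_mem[of i w] that by auto
qed

lemma baxter_points:
  assumes "baxter_perm n w"
  shows "avoids_3142 (points n w)" "avoids_3142 (vflip ` points n w)"
proof -
  have w: "length w = n" "baxter w" using assms perm_list by (auto simp: baxter_perm_def)
  have "strict_mono_on {..<length w} (\<lambda>i. coord n (Suc i))" "strict_mono_on (set w) (coord n)"
    by (auto simp: strict_mono_on_def coord_def)
  from baxter_iff_avoids_3142[OF this] w
  show "avoids_3142 (points n w)" "avoids_3142 (vflip ` points n w)"
    by (auto simp: points_def)
qed

lemma baxter_insert_points: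
  assumes "w \<in> permutations_of_set {1..n}" "p \<le> n" "baxter (insert_largest p w)"
  defines "S \<equiv> insert (2 * int p - int n, int n + 1) (points n w)"
  shows "avoids_3142 S" "avoids_3142 (vflip ` S)"
proof -
  note w = perm_list[OF assms(1)]
  define v where "v = insert_largest p w"
  \<comment> \<open>Old columns keep their coordinates and the inserted one lies in gap
    \<open>p\<close>. Beyond it the index is already one larger, hence \<open>coord n i\<close>
    without \<open>Suc\<close>.\<close>
  define g where "g i = (if i < p then coord n (Suc i) else if i = p then 2 * int p - int n else coord n i)" for i
  have len: "length v = Suc n" using w assms(2) by (simp add: v_def insert_largest_def)
  have v: "v ! i = (if i < p then w ! i else if i = p then Suc n else w ! (i - 1))" if "i < Suc n" for i
    using that w assms(2) by (auto simp: v_def insert_largest_def nth_append nth_Cons')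
  have "strict_mono_on {..<length v} g" "strict_mono_on (set v) (coord n)"
    by (auto simp: strict_mono_on_def coord_def g_def)
  note * = baxter_iff_avoids_3142[OF this]
  let ?pt = "\<lambda>i. (g i, coord n (v ! i))"
  have split: "{..<Suc n} = {..<p} \<union> {p} \<union> Suc ` {p..<n}"
    using assms(2) by auto
  have "?pt ` {..<p} = (\<lambda>i. (coord n (Suc i), coord n (w ! i))) ` {..<p}"
    using assms(2) v by (intro image_cong) (auto simp: g_def)
  moreover have "?pt ` {p} = {(2 * int p - int n, int n + 1)}"
    using assms(2) v by (auto simp: g_def coord_def)
  moreover have "?pt ` Suc ` {p..<n} = (\<lambda>i. (coord n (Suc i), coord n (w ! i))) ` {p..<n}"
    unfolding image_image using assms(2) v by (intro image_cong) (auto simp: g_def)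
  moreover have "{..<n} = {..<p} \<union> {p..<n}" using assms(2) by auto
  ultimately have "?pt ` {..<Suc n} = S"
    unfolding S_def points_def split image_Un by (simp add: image_Un)
  then show "avoids_3142 S" "avoids_3142 (vflip ` S)"
    using * assms(3) by (auto simp: len v_def[symmetric])
qed

lemma points_finite: "finite (points n w)"
  and points_inj: "inj_on fst (points n w)"
  by (auto simp: points_def inj_on_def coord_def)

lemma points_fst: "fst ` points n w = (\<lambda>i. coord n (Suc i)) ` {..<n}"
  by (simp add: points_def image_image)

lemma points_rot:
  assumes "w \<in> permutations_of_set {1..n}" "rotation_fixed w"
  shows "rot ` points n w = points n w"
proof (rule card_subset_eq)
  note w = perm_list[OF assms(1)]
  show "rot ` points n w \<subseteq> points n w"
  proof
    fix s assume "s \<in> rot ` points n w"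
    then obtain i where i: "i < n" "s = (coord n (w ! i), - coord n (Suc i))"
      by (auto simp: points_def rot_def)
    have j: "1 \<le> w ! i" "w ! i \<le> n" using w(4)[OF i(1)] by auto
    have "w ! (w ! i - 1) = n - i"
      using assms(2) i(1) j w(1) unfolding rotation_fixed_def
      by (auto dest!: bspec[of _ _ "Suc i"])
    then have "s = (coord n (Suc (w ! i - 1)), coord n (w ! (w ! i - 1)))"
      using i j by (simp add: coord_def)
    moreover have "w ! i - 1 < n" using j by simp
    ultimately show "s \<in> points n w" unfolding points_def by (intro image_eqI) auto
  qed
  have "inj_on rot (points n w)" by (auto simp: inj_on_def rot_def prod_eq_iff)
  then show "card (rot ` points n w) = card (points n w)" by (rule card_image)
qed (simp add: points_finite)

text \<open>For even \<open>n\<close> all coordinates are odd, and the point \<open>(1, a)\<close>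
  of a central column has its orbit in the columns \<open>1\<close>, \<open>- 1\<close>,
  \<open>a\<close>, \<open>- a\<close>. These four points form 3-14-2 if \<open>a > 1\<close> and
  2-41-3 if \<open>a < - 1\<close>.\<close>

lemma baxter_rotation_fixed_odd:
  assumes "baxter_perm n w" "rotation_fixed w" "n \<ge> 1"
  shows "odd n"
proof
  assume "even n"
  define S where "S = points n w"
  have perm: "w \<in> permutations_of_set {1..n}" using assms(1) by (simp add: baxter_perm_def)
  have rotS: "(y, - x) \<in> S" if "(x, y) \<in> S" for x y
    using points_rot[OF perm assms(2)] that unfolding S_def by (force simp: rot_def)
  have unique: "y = y'" if "(x, y) \<in> S" "(x, y') \<in> S" for x y y'
    using inj_onD[OF points_inj, of "(x, y)" "(x, y')"] that by (simp add: S_def)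
  have odd: "odd (fst s)" if "s \<in> S" for s
    using that \<open>even n\<close> by (auto simp: S_def points_def coord_def)
  have "1 = coord n (Suc (n div 2))" "n div 2 < n"
    using \<open>even n\<close> assms(3) by (auto simp: coord_def elim!: evenE)
  then have "(1, coord n (w ! (n div 2))) \<in> S" unfolding S_def points_def by auto
  then obtain a where a: "(1, a) \<in> S" by blast
  have pts: "(a, - 1) \<in> S" "(- 1, - a) \<in> S" "(- a, 1) \<in> S"
    using a rotS[OF a] rotS[OF rotS[OF a]] rotS[OF rotS[OF rotS[OF a]]] by simp_all
  \<comment> \<open>If \<open>a\<close> were \<open>1\<close> or \<open>- 1\<close>, the orbit would
    put two points into column \<open>1\<close>.\<close>
  have "a \<noteq> 1" using unique[OF a, of "- 1"] pts(1) by auto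
  moreover have "a \<noteq> - 1" using unique[OF a, of 1] pts(3) by auto
  moreover have "a \<noteq> 0" using odd[OF pts(1)] by auto
  ultimately have "a > 1 \<or> a < - 1" by linarith
  moreover have gap: "\<not> (- 1 < fst s \<and> fst s < 1)" if "s \<in> S" for s
    using odd[OF that] by presburger
  ultimately consider "a > 1" | "a < - 1" by blast
  then show False
  proof cases
    case 1
    have "occ_3142 S (- a, 1) (- 1, - a) (1, a) (a, - 1)"
      using 1 a pts gap unfolding occ_3142_def by simp
    then show False using baxter_points(1)[OF assms(1)] unfolding avoids_3142_def S_def by blast
  next
    case 2
    have "occ_3142 (vflip ` S) (vflip (a, - 1)) (vflip (- 1, - a)) (vflip (1, a)) (vflip (- a, 1))"
    proof -
      have "vflip (a, - 1) \<in> vflip ` S" "vflip (- 1, - a) \<in> vflip ` S" "vflip (1, a) \<in> vflip ` S"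
        "vflip (- a, 1) \<in> vflip ` S" using a pts by blast+
      then show ?thesis using 2 gap unfolding occ_3142_def by (auto simp: vflip_def)
    qed
    then show False using baxter_points(2)[OF assms(1)] unfolding avoids_3142_def S_def by blast
  qed
qed

text \<open>\<open>frame.avoids_all\<close> treats 3-14-2; applied to the mirror image of the
  diagram, with \<open>- t\<close> for \<open>t\<close>, it also excludes 2-41-3.\<close>

lemma framed_points_avoid:
  assumes "n \<ge> 1" "baxter_perm n w" "rotation_fixed w" "p \<le> n"
    and "baxter_perm (n + 1) (insert_largest p w)"
  defines "m \<equiv> int n + 1" and "t \<equiv> 2 * int p - int n"
  defines "S \<equiv> points n w \<union> {(t, m), (- m, t), (m, - t), (- t, - m)}"
  shows "frame (points n w) m t" "avoids_3142 S" "avoids_3142 (vflip ` S)"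
proof -
  define A where "A = points n w"
  have odd: "odd n" using baxter_rotation_fixed_odd assms by blast
  have perm: "w \<in> permutations_of_set {1..n}" using assms(2) by (simp add: baxter_perm_def)
  have rotA: "rot ` A = A" using points_rot[OF perm assms(3)] by (simp add: A_def)
  have rotin: "(y, - x) \<in> A" if "(x, y) \<in> A" for x y
    using rotA that by (force simp: rot_def)
  have injA: "inj_on fst A" using points_inj by (simp add: A_def)
  have even: "even (fst s)" if "s \<in> A" for s
    using that odd by (auto simp: A_def points_def coord_def)
  have bound: "\<bar>fst s\<bar> < m" if "s \<in> A" for s
    using that by (auto simp: A_def points_def coord_def m_def)
  have "0 = coord n (Suc (n div 2))" "n div 2 < n"
    using odd by (auto simp: coord_def elim!: oddE)
  then have "(0, coord n (w ! (n div 2))) \<in> A" unfolding A_def points_def by auto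
  then obtain a where a: "(0, a) \<in> A" by blast
  \<comment> \<open>The half turn keeps the central column and negates the height of its
    point.\<close>
  have "(0, - a) \<in> A" using rotin[OF rotin[OF a]] by simp
  then have "a = 0" using inj_onD[OF injA, of "(0, a)" "(0, - a)"] a by simp
  with a have origin: "(0, 0) \<in> A" by simp
  have t_odd: "odd t" using odd by (simp add: t_def)
  have t_bound: "\<bar>t\<bar> < m" using assms(4) by (simp add: t_def m_def)
  \<comment> \<open>For odd \<open>n\<close> the old abscissas are even, so parity separates them
    from \<open>t\<close> and \<open>- t\<close>.\<close>
  have t_new: "t \<notin> fst ` A" "- t \<notin> fst ` A" using even t_odd by fastforce+
  note avA = baxter_points[OF assms(2)]
  have avT: "avoids_3142 (insert (t, m) A)" "avoids_3142 (vflip ` insert (t, m) A)"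
    using baxter_insert_points[OF perm assms(4)] assms(5)
    by (simp_all add: baxter_perm_def A_def t_def m_def)
  show frame: "frame (points n w) m t"
    unfolding A_def[symmetric]
  proof (intro frame.intro)
    show "finite A" by (simp add: A_def points_finite)
    show "avoids_3142 A" using avA by (simp add: A_def)
  qed (use rotA injA bound origin t_bound t_new avT in simp_all)
  then show "avoids_3142 S" unfolding S_def by (rule frame.avoids_all)
  define B where "B = vflip ` A"
  have rotB: "rot ` B = B"
  proof -
    \<comment> \<open>Reflection conjugates the quarter turn to its inverse, which is its
      cube.\<close>
    have "rot ` vflip ` A = vflip ` rot ` rot ` rot ` A"
      by (simp add: image_image rot_def vflip_def)
    then show ?thesis by (simp add: rotA B_def)
  qed
  have fstB: "fst ` B = fst ` A" by (simp add: B_def image_image vflip_def)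
  have injB: "inj_on fst B" using injA by (auto simp: B_def inj_on_def vflip_def)
  have boundB: "\<bar>fst s\<bar> < m" if "s \<in> B" for s
    using that bound by (auto simp: B_def vflip_def)
  have sndB: "snd ` B = fst ` B" 
    using arg_cong[OF rotB, of "image fst"] by (simp add: image_image rot_def)
  have inj_sndB: "inj_on snd B"
  proof (rule inj_onI)
    fix x y assume "x \<in> B" "y \<in> B" "snd x = snd y"
    then have "rot x \<in> B" "rot y \<in> B" "fst (rot x) = fst (rot y)"
      using rotB by (blast, blast, simp add: rot_def)
    then have "rot x = rot y" using injB by (auto dest: inj_onD)
    then show "x = y" by (simp add: rot_def prod_eq_iff)
  qed
  \<comment> \<open>Reflection moves the inserted point to the bottom, at \<open>(t, - m)\<close>; a
    half turn takes it back to the top, at \<open>(- t, m)\<close>, and maps \<open>B\<close> to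
    itself.\<close>
  have "avoids_3142 (insert (- t, m) B)"
  proof -
    let ?C = "insert (t, - m) B"
    have "vflip ` insert (t, m) A = ?C" by (simp add: B_def vflip_def)
    with avT have avC: "avoids_3142 ?C" by simp
    have "- m \<notin> snd ` B"
    proof
      assume "- m \<in> snd ` B"
      then obtain s where "s \<in> B" "fst s = - m" unfolding sndB by auto
      then show False using boundB by fastforce
    qed
    then have inj1: "inj_on snd ?C" using inj_sndB by (subst inj_on_insert) auto
    have "inj_on fst ?C" using injB t_new fstB by (subst inj_on_insert) auto
    then have "inj_on snd (rot ` ?C)" by (rule inj_on_snd_rot)
    then have "avoids_3142 (rot ` rot ` ?C)"
      using avoids_3142_rot[OF inj1 avC] by (rule avoids_3142_rot)
    moreover have "rot ` rot ` ?C = insert (- t, m) B"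
      using rotB by (simp add: rot_def)
    ultimately show ?thesis by simp
  qed
  then have "frame B m (- t)"
  proof (intro frame.intro)
    show "finite B" by (simp add: B_def A_def points_finite)
    show "(0, 0) \<in> B" using imageI[OF origin, of vflip] by (simp add: B_def vflip_def)
    show "avoids_3142 B" using avA by (simp add: B_def A_def)
  qed (use rotB injB boundB t_bound t_new fstB in simp_all)
  then have "avoids_3142 (B \<union> {(- t, m), (- m, - t), (m, - (- t)), (- (- t), - m)})"
    by (rule frame.avoids_all)
  moreover have "B \<union> {(- t, m), (- m, - t), (m, - (- t)), (- (- t), - m)} = vflip ` S"
    by (auto simp: S_def B_def A_def image_Un vflip_def)
  ultimately show "avoids_3142 (vflip ` S)" by simp
qed

subsection \<open>From points back to lists\<close>

text \<open>Negating and reversing the sorted list gives a sorted list of the same set.\<close>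

lemma sorted_list_of_set_symmetric:
  fixes X :: "int set"
  assumes "finite X" "uminus ` X = X" "i < card X"
  shows "sorted_list_of_set X ! (card X - Suc i) = - (sorted_list_of_set X ! i)"
proof -
  let ?L = "sorted_list_of_set X"
  have "rev (map uminus ?L) = ?L"
  proof (rule sorted_distinct_set_unique)
    show "sorted (rev (map uminus ?L))"
      unfolding sorted_wrt_rev sorted_wrt_map by simp
    show "distinct (rev (map uminus ?L))" by (simp add: distinct_map)
  qed (use assms in auto)
  then have "?L ! (card X - Suc i) = rev (map uminus ?L) ! (card X - Suc i)" by simp
  also have "\<dots> = - (?L ! i)" using assms(3) by (simp add: rev_nth)
  finally show ?thesis .
qed

text \<open>Ordinates and abscissas form the same set by rotation invariance, so one enumeration
  \<open>g\<close> ranks both. This set is symmetric, so negation reverses ranks and invariance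
  becomes \<open>rotation_fixed\<close>.\<close>

lemma rotation_fixed_list_of_points:
  assumes fin: "finite S" and inj: "inj_on fst S" and rotS: "rot ` S = S"
  defines "N \<equiv> card S"
  obtains v and g :: "nat \<Rightarrow> int" where "v \<in> permutations_of_set {1..N}" "rotation_fixed v"
    "strict_mono_on {..<N} g" "S = (\<lambda>i. (g i, g (v ! i - 1))) ` {..<N}"
proof -
  define X where "X = fst ` S"
  define g where "g = nth (sorted_list_of_set X)"
  have rotin: "(y, - x) \<in> S" if "(x, y) \<in> S" for x y
    using imageI[OF that, of rot] rotS by (simp add: rot_def)
  have uniq: "y = y'" if "(x, y) \<in> S" "(x, y') \<in> S" for x y y'
    using inj_onD[OF inj, of "(x, y)" "(x, y')"] that by simp
  have finX: "finite X" and cardX: "card X = N"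
    using fin inj by (auto simp: X_def N_def card_image)
  have inX: "x \<in> X" "y \<in> X" if "(x, y) \<in> S" for x y
    using imageI[OF that, of fst] imageI[OF rotin[OF that], of fst] by (simp_all add: X_def)
  have symX: "uminus ` X = X"
  proof -
    have "- x \<in> X" if "x \<in> X" for x
    proof -
      obtain y where "(x, y) \<in> S" using \<open>x \<in> X\<close> unfolding X_def by auto
      from inX(1)[OF rotin[OF rotin[OF this]]] show ?thesis .
    qed
    then show ?thesis by (force simp: image_iff)
  qed
  have g_mono: "strict_mono_on {..<N} g"
    unfolding strict_mono_on_def g_def
    using sorted_wrt_nth_less[OF strict_sorted_list_of_set[of X]] by (simp add: cardX)
  then have g_inj: "inj_on g {..<N}" by (rule strict_mono_on_imp_inj_on)
  have g_range: "g ` {..<N} = X"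
    using nth_image[of N "sorted_list_of_set X"] finX
    by (simp add: g_def cardX atLeast0LessThan)
  have g_neg: "g (N - Suc i) = - g i" if "i < N" for i
    using sorted_list_of_set_symmetric[OF finX symX, of i] that by (simp add: g_def cardX)
  have "\<exists>k<N. (g i, g k) \<in> S" if "i < N" for i
  proof -
    have "g i \<in> X" using that g_range by blast
    then obtain y where y: "(g i, y) \<in> S" unfolding X_def by auto
    then have "y \<in> g ` {..<N}" using inX g_range by blast
    then show ?thesis using y by blast
  qed
  then obtain k where k: "\<And>i. i < N \<Longrightarrow> k i < N \<and> (g i, g (k i)) \<in> S" by metis
  define v where "v = map (\<lambda>i. Suc (k i)) [0..<N]"
  have v_nth: "v ! i = Suc (k i)" if "i < N" for i using that by (simp add: v_def)
  \<comment> \<open>Ranks start at 0 here. Turning the point \<open>(g i, g (k i))\<close> shows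
    that applying \<open>k\<close> twice reverses them.\<close>
  have kk: "k (k i) = N - Suc i" if "i < N" for i
  proof -
    have "(g (k i), - g i) \<in> S" "(g (k i), g (k (k i))) \<in> S"
      using k[OF that] k[of "k i"] rotin by blast+
    then have "g (k (k i)) = g (N - Suc i)" using uniq g_neg[OF that] by metis
    then show ?thesis using inj_onD[OF g_inj] k[of "k i"] k[OF that] that by simp
  qed
  have "inj_on k {..<N}"
    by (rule inj_onI) (metis kk diff_diff_cancel Suc_leI lessThan_iff nat.inject)
  then have dist: "distinct v" by (auto simp: v_def distinct_map inj_on_def)
  moreover have "set v \<subseteq> {1..N}" using k by (auto simp: v_def Suc_le_eq)
  then have "set v = {1..N}"
    using distinct_card[OF dist] by (intro card_subset_eq) (auto simp: v_def)
  ultimately have 1: "v \<in> permutations_of_set {1..N}" by (simp add: permutations_of_set_def)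
  have len: "length v = N" by (simp add: v_def)
  have 2: "rotation_fixed v"
    unfolding rotation_fixed_def len
  proof (intro ballI impI)
    fix i j assume i: "i \<in> {1..N}" and "j \<in> {1..N}" and j: "v ! (i - 1) = j"
    have i': "i - 1 < N" using i by auto
    have "j - 1 = k (i - 1)" using j v_nth[OF i'] by simp
    then have "v ! (j - 1) = Suc (k (k (i - 1)))" using v_nth k[OF i'] by simp
    then show "v ! (j - 1) = N + 1 - i" using kk[OF i'] i by auto
  qed
  have 3: "S = (\<lambda>i. (g i, g (v ! i - 1))) ` {..<N}"
  proof
    show "(\<lambda>i. (g i, g (v ! i - 1))) ` {..<N} \<subseteq> S" using k v_nth by auto
    show "S \<subseteq> (\<lambda>i. (g i, g (v ! i - 1))) ` {..<N}"
    proof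
      fix s assume s: "s \<in> S"
      then obtain i where i: "i < N" "fst s = g i" using g_range unfolding X_def by blast
      then have "s = (g i, g (k i))" using s k[OF i(1)] uniq by (metis prod.collapse)
      then show "s \<in> (\<lambda>i. (g i, g (v ! i - 1))) ` {..<N}" using i v_nth by auto
    qed
  qed
  show ?thesis by (rule that[OF 1 2 g_mono 3])
qed

text \<open>An entry of a permutation of \<open>{1..n}\<close> equals its own rank, and ranks depend
  only on the relative order.\<close>

lemma standardize_eqI:
  assumes "w \<in> permutations_of_set {1..n}" "length ys = n"
    and "\<And>i j. i < n \<Longrightarrow> j < n \<Longrightarrow> ys ! i \<le> ys ! j \<longleftrightarrow> w ! i \<le> w ! j"
  shows "standardize ys = w"
proof (rule nth_equalityI)
  note w = perm_list[OF assms(1)]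
  show "length (standardize ys) = length w" using w assms(2) by (simp add: standardize_def)
  fix i assume "i < length (standardize ys)"
  then have i: "i < n" using assms(2) by (simp add: standardize_def)
  let ?I = "{j \<in> {..<n}. w ! j \<le> w ! i}"
  have eq: "ys ! j = ys ! k \<longleftrightarrow> w ! j = w ! k" if "j < n" "k < n" for j k
    using assms(3) that by (metis order_antisym order_refl)
  have inj: "inj_on (nth w) {..<n}" using w by (intro inj_on_nth) auto
  then have inj': "inj_on (nth ys) {..<n}" using eq by (simp add: inj_on_def)
  have "{y \<in> set ys. y \<le> ys ! i} = nth ys ` ?I"
    using assms(2,3) i by (auto simp: set_conv_nth)
  then have "card {y \<in> set ys. y \<le> ys ! i} = card ?I"
    using card_image[OF inj_on_subset[OF inj', of ?I]] by auto
  also have "\<dots> = card (nth w ` ?I)"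
    using inj by (subst card_image) (auto intro: inj_on_subset)
  also have "nth w ` ?I = {x \<in> set w. x \<le> w ! i}"
    using w(1) by (auto simp: set_conv_nth)
  also have "\<dots> = {1..w ! i}" using w(2) w(4)[OF i] by auto
  finally show "standardize ys ! i = w ! i"
    using i assms(2) by (simp add: standardize_def)
qed

section \<open>Construction of the enlarged permutation\<close>

theorem theorem5p5:
  fixes n p :: nat and w :: "nat list"
  assumes "n \<ge> 1"
    and "baxter_perm n w"
    and "rotation_fixed w"
    and "p \<le> n"
    and "baxter_perm (n + 1) (insert_largest p w)"
  shows "\<exists>w'. baxter_perm (n + 4) w' \<and> rotation_fixed w' \<and>
           standardize (delete_outer w') = w \<and> largest_gap w' = p"
proof -
  define m where "m = int n + 1"
  define t where "t = 2 * int p - int n"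
  define A where "A = points n w"
  define N where "N = n + 4"
  have perm: "w \<in> permutations_of_set {1..n}" using assms(2) by (simp add: baxter_perm_def)
  note framed = framed_points_avoid[OF assms, folded m_def t_def A_def]
  interpret frame A m t by (fact framed(1))
  have "card A = n"
    using card_image[OF points_inj[of n w]] unfolding points_fst A_def
    by (subst (asm) card_image) (auto simp: inj_on_def coord_def)
  then have card: "card (A \<union> outer) = N" using card_all by (simp add: N_def)
  obtain v and g :: "nat \<Rightarrow> int" where v: "v \<in> permutations_of_set {1..N}" "rotation_fixed v"
    and g: "strict_mono_on {..<N} g"
    and pts: "A \<union> outer = (\<lambda>i. (g i, g (v ! i - 1))) ` {..<N}"
    using rotation_fixed_list_of_points[OF _ inj_all rot_all] finite_S card by auto
  note vl = perm_list[OF v(1)]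
  have g_less: "g i < g j \<longleftrightarrow> i < j" and g_eq: "g i = g j \<longleftrightarrow> i = j" if "i < N" "j < N" for i j
    using strict_mono_on_less[OF g] strict_mono_on_eq[OF g] that by simp_all
  have pt: "(g i, g (v ! i - 1)) \<in> A \<union> outer" if "i < N" for i
    unfolding pts using that by blast
  have v_lt: "v ! i - 1 < N" if "i < N" for i using vl(4)[OF that] by linarith
  have "baxter v"
  proof -
    have "strict_mono_on (set v) (\<lambda>u. g (u - 1))"
      unfolding strict_mono_on_def vl(2) by (auto simp: g_less)
    then have "baxter v \<longleftrightarrow> avoids_3142 (A \<union> outer) \<and> avoids_3142 (vflip ` (A \<union> outer))"
      unfolding pts using baxter_iff_avoids_3142[of v g "\<lambda>u. g (u - 1)"] g by (simp only: vl(1))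
    then show ?thesis using framed(2,3) by (rule iffD2[OF _ conjI])
  qed
  have bd: "\<bar>g i\<bar> \<le> m" if "i < N" for i
    using pt[OF that] bounded t_bound by fastforce
  \<comment> \<open>The bound \<open>m\<close> is attained at \<open>(- m, t)\<close> and
    \<open>(m, - t)\<close>, which therefore occupy the first and last columns.\<close>
  have g_min: "g 0 = - m"
  proof -
    have "(- m, t) \<in> (\<lambda>i. (g i, g (v ! i - 1))) ` {..<N}" unfolding pts[symmetric] by simp
    then obtain i where i: "i < N" "g i = - m" by auto
    then have "g 0 \<le> - m" using g_less[of 0 i] by (cases "i = 0") auto
    then show ?thesis using bd[of 0] i by simp
  qed
  have g_max: "g (N - 1) = m"
  proof -
    have "(m, - t) \<in> (\<lambda>i. (g i, g (v ! i - 1))) ` {..<N}" unfolding pts[symmetric] by simp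
    then obtain i where i: "i < N" "g i = m" by auto
    then have "m \<le> g (N - 1)" using g_less[of i "N - 1"] by (cases "i = N - 1") auto
    then show ?thesis using bd[of "N - 1"] i by simp
  qed
  have MaxMin: "Max (set v) = N" "Min (set v) = 1"
    unfolding vl(2) by (auto simp: N_def intro!: Max_eqI Min_eqI)
  have N_pos: "0 < N" by (simp add: N_def)
  have ends: "hd v = v ! 0" "last v = v ! (N - 1)"
    using vl(1) N_pos by (auto simp: hd_conv_nth last_conv_nth)
  define I where "I = {i \<in> {..<N}. (g i, g (v ! i - 1)) \<in> A}"
  \<comment> \<open>Heights \<open>m\<close> and \<open>- m\<close> mark the largest and smallest
    entries, abscissas \<open>- m\<close> and \<open>m\<close> the first and last; old points have
    both coordinates strictly in between.\<close>
  have inner: "inner_entry v (v ! i) \<longleftrightarrow> i \<in> I" if i: "i < N" for i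
  proof -
    have "v ! i = N \<longleftrightarrow> g (v ! i - 1) = m"
      using g_eq[OF v_lt[OF i], of "N - 1"] vl(4)[OF i] g_max N_pos by auto
    moreover have "v ! i = 1 \<longleftrightarrow> g (v ! i - 1) = - m"
      using g_eq[OF v_lt[OF i], of 0] vl(4)[OF i] g_min N_pos by auto
    moreover have "v ! i = hd v \<longleftrightarrow> g i = - m"
      using g_eq[OF i, of 0] nth_eq_iff_index_eq[OF vl(3), of i 0] i vl(1) g_min by (simp add: ends)
    moreover have "v ! i = last v \<longleftrightarrow> g i = m"
      using g_eq[OF i, of "N - 1"] nth_eq_iff_index_eq[OF vl(3), of i "N - 1"] i vl(1) g_max
      by (simp add: ends)
    ultimately have "inner_entry v (v ! i) \<longleftrightarrow>
        g (v ! i - 1) \<noteq> m \<and> g (v ! i - 1) \<noteq> - m \<and> g i \<noteq> - m \<and> g i \<noteq> m"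
      unfolding inner_entry_def MaxMin by blast
    also have "\<dots> \<longleftrightarrow> (g i, g (v ! i - 1)) \<in> A"
    proof
      assume "(g i, g (v ! i - 1)) \<in> A"
      from bounded[OF this] bounded'[OF this]
      show "g (v ! i - 1) \<noteq> m \<and> g (v ! i - 1) \<noteq> - m \<and> g i \<noteq> - m \<and> g i \<noteq> m" by auto
    next
      assume "g (v ! i - 1) \<noteq> m \<and> g (v ! i - 1) \<noteq> - m \<and> g i \<noteq> - m \<and> g i \<noteq> m"
      then show "(g i, g (v ! i - 1)) \<in> A" using pt[OF i] by blast
    qed
    finally show ?thesis using i by (simp add: I_def)
  qed
  have gI: "g ` I = fst ` A"
  proof
    show "g ` I \<subseteq> fst ` A" unfolding I_def by force
    show "fst ` A \<subseteq> g ` I"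
    proof
      fix x assume "x \<in> fst ` A"
      then obtain y where xy: "(x, y) \<in> A" by auto
      then have "(x, y) \<in> (\<lambda>i. (g i, g (v ! i - 1))) ` {..<N}" unfolding pts[symmetric] by simp
      then show "x \<in> g ` I" using xy unfolding I_def by auto
    qed
  qed
  have filter_inner: "filter (inner_entry v) (take k v) = map (nth v) (filter (\<lambda>i. i \<in> I) [0..<k])"
    if "k \<le> N" for k
  proof -
    have "take k v = map (nth v) [0..<k]"
      using that vl(1) by (intro nth_equalityI) auto
    then have "filter (inner_entry v) (take k v) = map (nth v) (filter (inner_entry v \<circ> nth v) [0..<k])"
      by (simp add: filter_map)
    also have "filter (inner_entry v \<circ> nth v) [0..<k] = filter (\<lambda>i. i \<in> I) [0..<k]"
      using that inner by (intro filter_cong) auto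
    finally show ?thesis .
  qed
  define js where "js = filter (\<lambda>i. i \<in> I) [0..<N]"
  have set_js: "set js = I" by (auto simp: js_def I_def)
  \<comment> \<open>Both sides are increasing lists with the same set, so the surviving columns are
    those of \<open>w\<close>, in order.\<close>
  have xs: "map g js = map (\<lambda>i. coord n (Suc i)) [0..<n]"
  proof (rule sorted_distinct_set_unique)
    have "sorted_wrt (<) js" by (simp add: js_def sorted_wrt_filter)
    then have "sorted_wrt (<) (map g js)"
      unfolding sorted_wrt_map
      by (rule sorted_wrt_mono_rel[rotated]) (auto simp: set_js I_def g_less)
    then show "sorted (map g js)" "distinct (map g js)" by (simp_all add: strict_sorted_iff)
    show "set (map g js) = set (map (\<lambda>i. coord n (Suc i)) [0..<n])"
      using gI points_fst[of n w] by (simp add: set_js A_def atLeast0LessThan)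
  qed (auto simp: sorted_wrt_iff_nth_less distinct_map inj_on_def coord_def)
  have len_js: "length js = n" using arg_cong[OF xs, of length] by simp
  have val: "js ! i < N" "g (v ! (js ! i) - 1) = coord n (w ! i)" if "i < n" for i
  proof -
    have "js ! i \<in> I" using that len_js set_js nth_mem by blast
    then have *: "js ! i < N" "(g (js ! i), g (v ! (js ! i) - 1)) \<in> A" by (auto simp: I_def)
    then show "js ! i < N" by simp
    have "g (js ! i) = coord n (Suc i)"
      using arg_cong[OF xs, of "\<lambda>l. l ! i"] that len_js by simp
    moreover have "(coord n (Suc i), coord n (w ! i)) \<in> A"
      using that by (auto simp: A_def points_def)
    ultimately show "g (v ! (js ! i) - 1) = coord n (w ! i)"
      using inj_onD[OF inj_fst _ *(2)] by fastforce
  qed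
  have del: "delete_outer v = map (nth v) js"
    using filter_inner[of N] vl(1) by (simp add: delete_outer_def js_def)
  have std: "standardize (delete_outer v) = w"
  proof (rule standardize_eqI[OF perm])
    show "length (delete_outer v) = n" by (simp add: del len_js)
    fix i j assume ij: "i < n" "j < n"
    have "v ! (js ! i) \<le> v ! (js ! j) \<longleftrightarrow> \<not> v ! (js ! j) - 1 < v ! (js ! i) - 1"
      using vl(4)[OF val(1)[OF ij(1)]] vl(4)[OF val(1)[OF ij(2)]] by linarith
    also have "\<dots> \<longleftrightarrow> \<not> coord n (w ! j) < coord n (w ! i)"
      using g_less[OF v_lt v_lt, OF val(1) val(1), OF ij(2,1)] val(2) ij by simp
    also have "\<dots> \<longleftrightarrow> w ! i \<le> w ! j" by (auto simp: coord_def)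
    finally show "delete_outer v ! i \<le> delete_outer v ! j \<longleftrightarrow> w ! i \<le> w ! j"
      using ij by (simp add: del len_js)
  qed
  have "(t, m) \<in> (\<lambda>i. (g i, g (v ! i - 1))) ` {..<N}" unfolding pts[symmetric] by simp
  \<comment> \<open>\<open>q\<close> is the index of the new top point, where
    \<open>takeWhile\<close> will stop.\<close>
  then obtain q where q: "q < N" "g q = t" "g (v ! q - 1) = m" by auto
  have vq: "v ! q = N"
    using g_eq[OF v_lt[OF q(1)], of "N - 1"] vl(4)[OF q(1)] g_max q(3) N_pos by auto
  have "takeWhile (\<lambda>x. x \<noteq> Max (set v)) v = take q v"
  proof (rule takeWhile_eq_take_P_nth)
    fix i assume "i < q" "i < length v"
    then have "v ! i \<noteq> v ! q" using vl(1,3) q(1) by (simp add: nth_eq_iff_index_eq)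
    then show "v ! i \<noteq> Max (set v)" by (simp add: MaxMin vq)
  qed (simp add: MaxMin vq)
  then have "largest_gap v = length (filter (\<lambda>i. i \<in> I) [0..<q])"
    using filter_inner[of q] q(1) by (simp add: largest_gap_def)
  also have "\<dots> = card {i \<in> I. i < q}"
    using distinct_card[of "filter (\<lambda>i. i \<in> I) [0..<q]"] by (simp add: conj_commute Collect_conj_eq Int_commute)
  also have "\<dots> = card (g ` {i \<in> I. i < q})"
    using g_eq by (intro card_image[symmetric] inj_onI) (auto simp: I_def)
  also have "g ` {i \<in> I. i < q} = {x \<in> g ` I. x < t}"
    using g_less[OF _ q(1)] q(2) by (auto simp: I_def)
  \<comment> \<open>The abscissa \<open>coord n (Suc i)\<close> is less than
    \<open>2 * int p - int n\<close> exactly when \<open>i < p\<close>.\<close>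
  also have "\<dots> = (\<lambda>i. coord n (Suc i)) ` {..<p}"
    unfolding gI A_def points_fst using assms(4) by (auto simp: coord_def t_def)
  also have "card \<dots> = p"
    by (subst card_image) (auto simp: inj_on_def coord_def)
  finally have gap: "largest_gap v = p" .
  have "baxter_perm (n + 4) v" using v(1) \<open>baxter v\<close> by (simp add: baxter_perm_def N_def)
  then show ?thesis using v(2) std gap by blast
qed

end
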